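(* Let $(\mathsf H,L)$ be a canonical system and let $1/2\le d<1$. Assume that there is a constant $C>0$ such that for any $\varepsilon>0$ there exists a finite rank Hamiltonian $\mathsf H^\varepsilon$ defined on $(0,L)$ such that (a) $\displaystyle \|\mathsf H-\mathsf H^\varepsilon\|_{L^1(0,L)}\le\varepsilon$, (b) $\displaystyle \operatorname{Var}\mathsf H^\varepsilon\le C\,\varepsilon^{\frac{2d-1}{2d-2}}$. Then the order of the system $(\mathsf H,L)$ is not greater than $d$.
   Context: Canonical systems. Let $L>0$ and let $\mathsf H$ be a summable function on $[0,L]$ with values in $2\times2$ matrices such that $\mathsf H(x)\ge0$ and $\operatorname{tr}\mathsf H(x)=1$ for a.e. $x$. Let $J=\begin{pmatrix}0&-1\\1&0\end{pmatrix}$. The canonical system $(\mathsf H,L)$ is the equation $J\frac{dY}{dx}=z\mathsf H Y$, $z\in\mathbb C$, $x\in[0,L]$; $\mathsf H$ is called its Hamiltonian. Its matrix solution with $M(0,z)=I$ is denoted $M(x,z)$, and $M(z):=M(L,z)$ is the monodromy matrix, an entire matrix function of $z$. Order. The quantity $\limsup_{|z|\to\infty}\frac{\log\log|M_{ij}(z)|}{\log|z|}$ (the order of the entire function $M_{ij}$) does not depend on $i,j$ and is called the order of the system; it equals the order of the entire matrix function $M(z)$, i.e. $\limsup_{|z|\to\infty}\frac{\log\log\|M(z)\|}{\log|z|}$ (polynomials having order $0$). Finite rank Hamiltonians. A Hamiltonian $\mathsf G$ on $(0,L)$ is of finite rank if there exist numbers $0=x_0<x_1<\dots<x_N=L$ and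 unit vectors $e_0,\dots,e_{N-1}\in\mathbb R^2$ such that $\mathsf G(x)=\langle\cdot,e_j\rangle_{\mathbb C^2}e_j$ for $x\in(x_j,x_{j+1})$, $j=0,\dots,N-1$. For such $\mathsf G$ put $\operatorname{Var}\mathsf G:=\sum_{j=0}^{N-2}\|P_j-P_{j+1}\|$, where $P_j=\langle\cdot,e_j\rangle e_j$. $\|\cdot\|$ is the operator norm of $2\times2$ matrices, and $\|\mathsf F\|_{L^1(0,L)}=\int_0^L\|\mathsf F(t)\|\,dt$. *)

theory Defs
  imports "HOL-Analysis.Analysis"
begin

type_synonym cmat2 = "complex^2^2"

(* The norm of the type class on complex^2^2 is the Frobenius norm, so the operator norm
   is taken explicitly. *)
definition opnorm :: "cmat2 \<Rightarrow> real" where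
  "opnorm A = onorm (\<lambda>v. A *v v)"

(* Over the complex numbers this condition on the quadratic form already makes A Hermitian. *)
definition psd :: "cmat2 \<Rightarrow> bool" where
  "psd A \<longleftrightarrow> (\<forall>v. (\<Sum>i\<in>UNIV. cnj (v $ i) * (A *v v) $ i) \<in> \<real>\<^sub>\<ge>\<^sub>0)"

definition symplectic_J :: cmat2 where
  "symplectic_J = vector [vector [0, -1], vector [1, 0]]"

definition canonical_system :: "(real \<Rightarrow> cmat2) \<Rightarrow> real \<Rightarrow> bool" where
  "canonical_system H L \<longleftrightarrow>
     L > 0 \<and> H absolutely_integrable_on {0..L} \<and>
     (AE x in lebesgue. x \<in> {0..L} \<longrightarrow> psd (H x) \<and> trace (H x) = 1)"

(* Y is absolutely continuous on [0,L] with almost everywhere derivative Y', expressed by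
   saying that Y is an indefinite Lebesgue integral of Y'. *)
definition has_ac_derivative_on ::
    "(real \<Rightarrow> cmat2) \<Rightarrow> (real \<Rightarrow> cmat2) \<Rightarrow> real \<Rightarrow> bool" where
  "has_ac_derivative_on Y Y' L \<longleftrightarrow>
     Y' absolutely_integrable_on {0..L} \<and> (\<forall>x\<in>{0..L}. Y x = Y 0 + integral {0..x} Y')"

(* As H is only summable, the differential equation is read in the Caratheodory sense:
   absolutely continuous solutions, equation satisfied almost everywhere. These conditions
   determine M x z for all x in [0,L] and all z. *)
definition matrix_solution ::
    "(real \<Rightarrow> cmat2) \<Rightarrow> real \<Rightarrow> (real \<Rightarrow> complex \<Rightarrow> cmat2) \<Rightarrow> bool" where
  "matrix_solution H L M \<longleftrightarrow>
     (\<forall>z. M 0 z = mat 1 \<and>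
       (\<exists>Y'. has_ac_derivative_on (\<lambda>x. M x z) Y' L \<and>
         (AE x in lebesgue. x \<in> {0..L} \<longrightarrow>
            symplectic_J ** Y' x = mat z ** H x ** M x z)))"

(* limsup of log log (phi z) / log |z| as |z| tends to infinity, for a modulus phi >= 0.
   The outer logarithm is truncated at 0 so that log log is total (recall ln 0 = 0); this
   changes the limsup only where it would be negative, and gives every polynomial,
   constants included, order 0. *)
definition growth_order :: "(complex \<Rightarrow> real) \<Rightarrow> ereal" where
  "growth_order \<phi> =
     Limsup at_infinity (\<lambda>z. ereal (ln (max 1 (ln (\<phi> z))) / ln (cmod z)))"

definition proj :: "real^2 \<Rightarrow> cmat2" where
  "proj e = (\<chi> i k. complex_of_real (e $ i * e $ k))"

definition finite_rank_hamiltonian ::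
    "real \<Rightarrow> nat \<Rightarrow> (nat \<Rightarrow> real) \<Rightarrow> (nat \<Rightarrow> real^2) \<Rightarrow> (real \<Rightarrow> cmat2) \<Rightarrow> bool" where
  "finite_rank_hamiltonian L N x e G \<longleftrightarrow>
     x 0 = 0 \<and> x N = L \<and>
     (\<forall>j<N. x j < x (Suc j) \<and> norm (e j) = 1 \<and>
        (\<forall>t\<in>{x j<..<x (Suc j)}. G t = proj (e j)))"

(* Subdividing intervals on which G is constant adds only zero terms, so this sum depends
   on G alone and not on the representation (N, x, e). *)
definition Var :: "nat \<Rightarrow> (nat \<Rightarrow> real^2) \<Rightarrow> real" where
  "Var N e = (\<Sum>j<N - 1. opnorm (proj (e j) - proj (e (Suc j))))"

definition L1_norm :: "real \<Rightarrow> (real \<Rightarrow> cmat2) \<Rightarrow> real" where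
  "L1_norm L F = (LINT t:{0..L}|lebesgue. opnorm (F t))"

end

theory Submission
  imports Defs
begin

text \<open>Fix \<open>z\<close> with \<open>r = cmod z \<ge> 1\<close> and put \<open>\<delta> = r powr (d - 1)\<close>, \<open>\<epsilon> = \<delta>\<^sup>2\<close>. Let \<open>P\<^sub>j\<close> be
  the projections of the finite rank Hamiltonian chosen for \<open>\<epsilon>\<close>. On the j-th interval a
  solution \<open>y\<close> is measured by the norm of \<open>D\<^sub>j y\<close>, where \<open>D\<^sub>j = P\<^sub>j + \<delta> (1 - P\<^sub>j)\<close>. Since
  \<open>P\<^sub>j J P\<^sub>j = 0\<close>, conjugation by \<open>D\<^sub>j\<close> shrinks \<open>J P\<^sub>j\<close> by the factor \<open>\<delta>\<close> and enlarges the
  error \<open>H - P\<^sub>j\<close> by at most \<open>1 / \<delta>\<close>, while passing from \<open>D\<^sub>j\<close> to the next one costs a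
  factor of at most \<open>1 + \<parallel>P\<^sub>j - P\<^sub>j\<^sub>+\<^sub>1\<parallel> / \<delta>\<close>. Gronwall's inequality then bounds
  \<open>ln \<parallel>M(z)\<parallel>\<close> by \<open>2 r (\<delta> L + \<epsilon> / \<delta>) + Var / \<delta> + ln (1 / \<delta>)\<close>, and each of these terms is
  \<open>O(r powr d)\<close> for the given choice of \<open>\<delta>\<close> and \<open>\<epsilon>\<close>.\<close>


section \<open>Gronwall's inequality for indefinite integrals\<close>

text \<open>The constant 2 in place of the sharp constant 1 is harmless here. It lets the bound be read
  off directly from the maximum of \<open>norm (W x)\<close> over intervals on which \<open>k\<close> has integral at
  most 1/2, so that no chain rule for absolutely continuous functions is needed.\<close>
lemma integral_gronwall:
  fixes W F :: "real \<Rightarrow> 'a::euclidean_space" and k :: "real \<Rightarrow> real"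
  assumes "a \<le> b" and "negligible Z"
    and F: "F integrable_on {a..b}" and k: "k integrable_on {a..b}"
    and W: "\<And>x. x \<in> {a..b} \<Longrightarrow> W x = W a + integral {a..x} F"
    and k0: "\<And>x. x \<in> {a..b} \<Longrightarrow> 0 \<le> k x"
    and bound: "\<And>x. x \<in> {a..b} - Z \<Longrightarrow> norm (F x) \<le> k x * norm (W x)"
  shows "norm (W b) \<le> norm (W a) * exp (2 * integral {a..b} k)"
proof -
  \<comment> \<open>The inequalities in the premises are guards: the local half of
    \<open>Bolzano\<close> ranges over all short intervals around a point, including those that
    leave \<open>{a..b}\<close>.\<close>
  define P where "P s t \<longleftrightarrow> a \<le> s \<longrightarrow> s \<le> t \<longrightarrow> t \<le> b \<longrightarrow>
    norm (W t) \<le> norm (W s) * exp (2 * integral {s..t} k)" for s t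
  have Fsub: "F integrable_on {s..t}" and ksub: "k integrable_on {s..t}" if "a \<le> s" "t \<le> b" for s t
    using that F k integrable_subinterval_real by (metis atLeastatMost_subset_iff)+
  have Wdiff: "W t = W s + integral {s..t} F" if "a \<le> s" "s \<le> t" "t \<le> b" for s t
    using Henstock_Kurzweil_Integration.integral_combine[OF that(1,2) Fsub] W[of s] W[of t] that
    by (simp add: algebra_simps)
  have contW: "continuous_on {a..b} W"
  proof -
    have "continuous_on {a..b} (\<lambda>x. W a + integral {a..x} F)"
      by (intro continuous_intros indefinite_integral_continuous_1 F)
    then show ?thesis
      by (rule continuous_on_eq) (rule W[symmetric])
  qed
  have contK: "continuous_on {a..b} (\<lambda>x. integral {a..x} k)"
    by (intro indefinite_integral_continuous_1 k)
  have short: "P s t" if st: "a \<le> s" "s \<le> t" "t \<le> b" and half: "integral {s..t} k \<le> 1/2" for s t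
  proof -
    define q where "q = integral {s..t} k"
    have q0: "0 \<le> q"
      unfolding q_def using st k0 by (intro integral_nonneg ksub) auto
    have "continuous_on {s..t} (\<lambda>x. norm (W x))"
      using contW st by (intro continuous_intros) (auto intro: continuous_on_subset)
    then obtain c where c: "c \<in> {s..t}" and cmax: "\<And>x. x \<in> {s..t} \<Longrightarrow> norm (W x) \<le> norm (W c)"
      using continuous_attains_sup[of "{s..t}" "\<lambda>x. norm (W x)"] st by auto
    \<comment> \<open>The pointwise bound is available only off \<open>Z\<close>, so the integrand
      is set to 0 there, which leaves its integral unchanged.\<close>
    let ?F' = "\<lambda>x. if x \<in> Z then 0 else F x"
    have "norm (integral {s..c} F) = norm (integral {s..c} ?F')"
      using \<open>negligible Z\<close> by (subst integral_spike[of Z _ ?F' F]) auto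
    also have "\<dots> \<le> integral {s..c} (\<lambda>x. norm (W c) * k x)"
    proof (rule Henstock_Kurzweil_Integration.integral_norm_bound_integral)
      show "?F' integrable_on {s..c}"
        using integrable_spike[OF Fsub \<open>negligible Z\<close>, of s c ?F'] c st by auto
      show "(\<lambda>x. norm (W c) * k x) integrable_on {s..c}"
        using c st ksub[of s c] integrable_on_cmult_left by fastforce
      fix x assume x: "x \<in> {s..c}"
      have "k x * norm (W x) \<le> norm (W c) * k x"
        using cmax[of x] k0[of x] c st x by (simp add: mult.commute mult_left_mono)
      then show "norm (?F' x) \<le> norm (W c) * k x"
        using bound[of x] k0[of x] x c st by auto
    qed
    also have "\<dots> = norm (W c) * integral {s..c} k" by simp
    also have "\<dots> \<le> norm (W c) * q"
      unfolding q_def using c st k0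
      by (intro mult_left_mono integral_subset_le ksub) auto
    finally have "norm (W c) \<le> norm (W s) + norm (W c) * q"
      using Wdiff[of s c] c st norm_triangle_ineq[of "W s" "integral {s..c} F"] by auto
    then have 1: "norm (W c) * (1 - q) \<le> norm (W s)"
      by (simp add: algebra_simps)
    \<comment> \<open>The product equals \<open>1 + q - 2 * q\<^sup>2\<close>, which is at least 1
      exactly when \<open>q\<close> lies between 0 and 1/2; hence the pairing of the constants 1/2
      and 2.\<close>
    have "1 \<le> (1 - q) * (1 + 2 * q)"
      using half q0 mult_left_mono[of q "1/2" q] unfolding q_def[symmetric] by (simp add: algebra_simps)
    also have "\<dots> \<le> (1 - q) * exp (2 * q)"
      using half exp_ge_add_one_self[of "2 * q"] unfolding q_def[symmetric] by (intro mult_left_mono) auto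
    finally have "norm (W c) * 1 \<le> norm (W c) * ((1 - q) * exp (2 * q))"
      by (intro mult_left_mono) auto
    also have "\<dots> \<le> norm (W s) * exp (2 * q)"
      using 1 by (simp add: mult.assoc[symmetric])
    finally show ?thesis
      using cmax[of t] st unfolding P_def q_def by auto
  qed
  have "P a b"
    using \<open>a \<le> b\<close>
  proof (induction rule: Bolzano)
    case (trans s t u)
    show ?case
      unfolding P_def
    proof (intro impI)
      assume "a \<le> s" "s \<le> u" "u \<le> b"
      have tu: "norm (W u) \<le> norm (W t) * exp (2 * integral {t..u} k)"
        using trans \<open>a \<le> s\<close> \<open>u \<le> b\<close> unfolding P_def by auto
      have st: "norm (W t) \<le> norm (W s) * exp (2 * integral {s..t} k)"
        using trans \<open>a \<le> s\<close> \<open>u \<le> b\<close> unfolding P_def by auto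
      have "integral {s..u} k = integral {s..t} k + integral {t..u} k"
        using Henstock_Kurzweil_Integration.integral_combine[of s t u k] ksub[of s u] trans \<open>a \<le> s\<close> \<open>u \<le> b\<close> by auto
      then show "norm (W u) \<le> norm (W s) * exp (2 * integral {s..u} k)"
        using order_trans[OF tu mult_right_mono[OF st, of "exp (2 * integral {t..u} k)"]]
        by (simp add: distrib_left exp_add mult.assoc)
    qed
  next
    case (local x)
    \<comment> \<open>Each endpoint moves the primitive of \<open>k\<close> by less than 1/4, so the
      integral between the endpoints stays below 1/2.\<close>
    then obtain r where r: "r > 0"
      "\<And>y. y \<in> {a..b} \<Longrightarrow> \<bar>y - x\<bar> < r \<Longrightarrow> \<bar>integral {a..y} k - integral {a..x} k\<bar> < 1/4"
      using contK[unfolded continuous_on_iff, rule_format, of x "1/4"] by (auto simp: dist_real_def)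
    show ?case
    proof (intro exI conjI allI impI)
      fix s t assume *: "s \<le> x \<and> x \<le> t \<and> t - s < r"
      show "P s t"
      proof (cases "a \<le> s \<and> t \<le> b")
        case True
        have "integral {a..t} k = integral {a..s} k + integral {s..t} k"
          using Henstock_Kurzweil_Integration.integral_combine[of a s t k] ksub[of a t] * True by auto
        then have "integral {s..t} k \<le> 1/2"
          using r(2)[of s] r(2)[of t] * True unfolding abs_less_iff by (auto simp: algebra_simps)
        then show ?thesis using short * True by auto
      qed (auto simp: P_def)
    qed (use r in auto)
  qed
  then show ?thesis using \<open>a \<le> b\<close> by (simp add: P_def)
qed

section \<open>Operator norm of complex 2x2 matrices\<close>

lemma norm_mult_vec_le_opnorm: "norm (A *v v) \<le> opnorm A * norm v"
  unfolding opnorm_def by (rule onorm) simp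

lemma opnorm_nonneg: "0 \<le> opnorm A"
  unfolding opnorm_def by (rule onorm_pos_le) simp

lemma opnorm_le: "(\<And>v. norm (A *v v) \<le> b * norm v) \<Longrightarrow> opnorm A \<le> b"
  unfolding opnorm_def by (rule onorm_le)

lemma opnorm_add_le: "opnorm (A + B) \<le> opnorm A + opnorm B"
  unfolding opnorm_def matrix_vector_mult_add_rdistrib by (rule onorm_triangle) simp_all

lemma opnorm_minus_commute: "opnorm (A - B) = opnorm (B - A)"
proof -
  have "norm ((A - B) *v v) = norm ((B - A) *v v)" for v
    by (simp add: matrix_vector_mult_diff_rdistrib norm_minus_commute)
  then show ?thesis by (simp add: opnorm_def onorm_def)
qed

lemma norm_entry_le_opnorm: "norm (A $ i $ j) \<le> opnorm A"
proof -
  have "A $ i $ j = (A *v axis j 1) $ i"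
    by (simp add: matrix_vector_mult_def axis_def if_distrib[of "(*) _"] cong: if_cong)
  then have "norm (A $ i $ j) \<le> norm (A *v axis j 1)"
    by (metis Finite_Cartesian_Product.norm_nth_le)
  also have "\<dots> \<le> opnorm A"
    using norm_mult_vec_le_opnorm[of A "axis j 1"] by (simp add: norm_eq_1[of "axis j 1"] inner_axis_axis)
  finally show ?thesis .
qed

text \<open>Each of the four entries is at most \<open>norm A\<close>. The crude constant is enough
  for the two uses: continuity of \<open>opnorm\<close> and an integrable majorant.\<close>

lemma opnorm_le_norm: "opnorm A \<le> 4 * norm A"
proof (rule opnorm_le)
  fix v :: "complex^2"
  have "norm (A *v v) \<le> (\<Sum>i\<in>UNIV. norm ((A *v v) $ i))"
    unfolding norm_vec_def by (rule L2_set_le_sum) simp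
  also have "\<dots> \<le> (\<Sum>i\<in>(UNIV::2 set). 2 * norm A * norm v)"
  proof (rule sum_mono)
    fix i
    have e: "norm (A $ i $ j) * norm (v $ j) \<le> norm A * norm v" for j
      by (intro mult_mono order_trans[OF Finite_Cartesian_Product.norm_nth_le]
          Finite_Cartesian_Product.norm_nth_le) auto
    have "norm ((A *v v) $ i) \<le> (\<Sum>j\<in>UNIV. norm (A $ i $ j) * norm (v $ j))"
      unfolding matrix_vector_mult_def by (simp add: sum_norm_le norm_mult)
    also have "\<dots> \<le> (\<Sum>j\<in>(UNIV::2 set). norm A * norm v)"
      by (intro sum_mono e)
    finally show "norm ((A *v v) $ i) \<le> 2 * norm A * norm v" by simp
  qed
  finally show "norm (A *v v) \<le> 4 * norm A * norm v" by simp
qed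

lemma continuous_on_opnorm: "continuous_on UNIV opnorm"
proof -
  have lip: "\<bar>opnorm A - opnorm B\<bar> \<le> 4 * norm (A - B)" for A B
    using opnorm_add_le[of "A - B" B] opnorm_add_le[of "B - A" A]
      opnorm_le_norm[of "A - B"] opnorm_le_norm[of "B - A"] norm_minus_commute[of A B]
    by simp
  show ?thesis
    by (rule lipschitz_on_continuous_on[of 4], rule lipschitz_onI) (use lip in \<open>auto simp: dist_norm\<close>)
qed

text \<open>Continuity of \<open>opnorm\<close> gives measurability, and a multiple of the norm
  dominates. This lets the Lebesgue integral in \<open>L1_norm\<close> be read as the gauge integral
  of \<open>integral_gronwall\<close>.\<close>

lemma absolutely_integrable_opnorm:
  fixes F :: "real \<Rightarrow> cmat2"
  assumes "F absolutely_integrable_on S" "S \<in> sets lebesgue"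
  shows "(\<lambda>t. opnorm (F t)) absolutely_integrable_on S"
proof (rule measurable_bounded_by_integrable_imp_absolutely_integrable)
  have "F \<in> borel_measurable (lebesgue_on S)"
    using assms(1) unfolding absolutely_integrable_measurable[OF assms(2)] by simp
  then show "(\<lambda>t. opnorm (F t)) \<in> borel_measurable (lebesgue_on S)"
    by (rule measurable_compose[OF _ borel_measurable_continuous_onI[OF continuous_on_opnorm]])
  show "(\<lambda>t. 4 * norm (F t)) integrable_on S"
    using assms(1) integrable_on_cmult_left[of "\<lambda>t. norm (F t)" S 4]
    unfolding absolutely_integrable_on_def by simp
qed (use assms opnorm_le_norm opnorm_nonneg in auto)

section \<open>Damped norms adapted to a direction\<close>

text \<open>On a stretch where the Hamiltonian is \<open>proj e\<close>, the generator
  \<open>- J proj e\<close> maps \<open>e\<close> to a multiple of its orthogonal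
  complement and kills that complement; damping the complement by \<open>\<delta>\<close>
  makes the generator small.\<close>
definition damp :: "real \<Rightarrow> real^2 \<Rightarrow> complex^2 \<Rightarrow> complex^2" where
  "damp \<delta> e v = \<delta> *\<^sub>R v + (1 - \<delta>) *\<^sub>R (proj e *v v)"

lemma bounded_linear_damp: "bounded_linear (damp \<delta> e)"
  unfolding damp_def
  by (intro bounded_linear_add bounded_linear_compose[OF bounded_linear_scaleR_right]
      bounded_linear_ident matrix_vector_mul_bounded_linear)

lemma norm_complex2: "(norm (v::complex^2))\<^sup>2 = (cmod (v$1))\<^sup>2 + (cmod (v$2))\<^sup>2"
  by (simp add: norm_vec_def L2_set_def sum_2)

lemma norm_real2: "(norm (v::real^2))\<^sup>2 = (v$1)\<^sup>2 + (v$2)\<^sup>2"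
  by (simp add: norm_vec_def L2_set_def sum_2)

text \<open>For a unit vector \<open>e\<close>, \<open>along\<close> and \<open>across\<close> are
  the coordinates of \<open>v\<close> in the rotated orthonormal basis \<open>e\<close>,
  \<open>J e = (- e$2, e$1)\<close>.\<close>

definition along :: "real^2 \<Rightarrow> complex^2 \<Rightarrow> complex" where
  "along e v = of_real (e$1) * v$1 + of_real (e$2) * v$2"

definition across :: "real^2 \<Rightarrow> complex^2 \<Rightarrow> complex" where
  "across e v = of_real (e$1) * v$2 - of_real (e$2) * v$1"

text \<open>In the basis \<open>e\<close>, \<open>J e\<close> the map is diagonal with entries 1 and
  \<open>\<delta>\<close>, so Pythagoras applies. The scaling and comparison lemmas below reduce to
  this formula.\<close>

lemma norm_damp:
  assumes "norm e = 1"
  shows "(norm (damp \<delta> e v))\<^sup>2 = (cmod (along e v))\<^sup>2 + \<delta>\<^sup>2 * (cmod (across e v))\<^sup>2"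
proof -
  have e: "(e$1)\<^sup>2 + (e$2)\<^sup>2 = 1"
    using norm_real2[of e] assms by simp
  have ec: "(complex_of_real (e$1))\<^sup>2 + (complex_of_real (e$2))\<^sup>2 = 1"
    using arg_cong[OF e, of complex_of_real] by simp
  \<comment> \<open>One identity serves both coordinates: the second arises from the first by
    interchanging the components of \<open>e\<close> and of \<open>v\<close>.\<close>
  have rotate: "\<delta>' * u + (1 - \<delta>') * (p * p * u + p * q * w)
      = p * (p * u + q * w) - \<delta>' * q * (p * w - q * u)"
    if "p\<^sup>2 + q\<^sup>2 = 1" for p q u w \<delta>' :: complex
  proof -
    have "\<delta>' * u + (1 - \<delta>') * (p * p * u + p * q * w)
        = \<delta>' * ((p\<^sup>2 + q\<^sup>2) * u) + (1 - \<delta>') * (p * p * u + p * q * w)"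
      using that by simp
    also have "\<dots> = p * (p * u + q * w) - \<delta>' * q * (p * w - q * u)"
      by (simp add: power2_eq_square algebra_simps)
    finally show ?thesis .
  qed
  have 1: "damp \<delta> e v $ 1 = of_real (e$1) * along e v - of_real (\<delta> * e$2) * across e v"
  proof -
    have "damp \<delta> e v $ 1 = of_real \<delta> * v$1 + (1 - of_real \<delta>) *
        (of_real (e$1) * of_real (e$1) * v$1 + of_real (e$1) * of_real (e$2) * v$2)"
      unfolding damp_def proj_def matrix_vector_mult_def
      by (simp add: sum_2) (simp add: scaleR_conv_of_real)
    then show ?thesis
      unfolding along_def across_def rotate[OF ec] by (simp add: mult.assoc)
  qed
  have 2: "damp \<delta> e v $ 2 = of_real (e$2) * along e v + of_real (\<delta> * e$1) * across e v"
  proof -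
    have "damp \<delta> e v $ 2 = of_real \<delta> * v$2 + (1 - of_real \<delta>) *
        (of_real (e$2) * of_real (e$2) * v$2 + of_real (e$2) * of_real (e$1) * v$1)"
      unfolding damp_def proj_def matrix_vector_mult_def
      by (simp add: sum_2) (simp add: scaleR_conv_of_real)
    then show ?thesis
      unfolding along_def across_def rotate[OF ec[unfolded add.commute[of "(complex_of_real (e$1))\<^sup>2"]]]
      by (simp add: algebra_simps)
  qed
  have "(norm (damp \<delta> e v))\<^sup>2 = ((e$1)\<^sup>2 + (e$2)\<^sup>2) *
      ((cmod (along e v))\<^sup>2 + \<delta>\<^sup>2 * (cmod (across e v))\<^sup>2)"
    unfolding norm_complex2 1 2 cmod_power2
    by (simp add: power2_eq_square algebra_simps)
  then show ?thesis using e by simp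
qed


lemma damp_1 [simp]: "damp 1 e v = v"
  by (simp add: damp_def)

lemma damp_add: "damp \<delta> e (u + v) = damp \<delta> e u + damp \<delta> e v"
  by (rule linear_add[OF bounded_linear.linear[OF bounded_linear_damp]])

lemma norm_damp_scale:
  assumes "norm e = 1"
  shows "norm (damp \<delta> e (c *s v)) = cmod c * norm (damp \<delta> e v)"
proof (rule power2_eq_imp_eq)
  have 1: "along e (c *s v) = c * along e v" "across e (c *s v) = c * across e v"
    by (simp_all add: along_def across_def algebra_simps)
  show "(norm (damp \<delta> e (c *s v)))\<^sup>2 = (cmod c * norm (damp \<delta> e v))\<^sup>2"
    unfolding power_mult_distrib norm_damp[OF assms] 1 norm_mult by (simp add: algebra_simps)
qed auto

lemma norm_damp_le:
  assumes "norm e = 1" "0 \<le> \<delta>" "\<delta> \<le> 1"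
  shows "norm (damp \<delta> e v) \<le> norm v"
proof (rule power2_le_imp_le)
  \<comment> \<open>The Euclidean norm is the case \<open>\<delta> = 1\<close>, which puts both
    sides in the same coordinates.\<close>
  have "(norm (damp \<delta> e v))\<^sup>2 \<le> (norm (damp 1 e v))\<^sup>2"
    unfolding norm_damp[OF assms(1)]
    using assms by (intro add_left_mono mult_right_mono power_mono) auto
  then show "(norm (damp \<delta> e v))\<^sup>2 \<le> (norm v)\<^sup>2" by simp
qed auto

lemma norm_le_damp:
  assumes "norm e = 1" "0 < \<delta>" "\<delta> \<le> 1"
  shows "norm v \<le> norm (damp \<delta> e v) / \<delta>"
proof -
  have "\<delta> * norm v \<le> norm (damp \<delta> e v)"
  proof (rule power2_le_imp_le)
    have "\<delta>\<^sup>2 * (norm (damp 1 e v))\<^sup>2 \<le> (norm (damp \<delta> e v))\<^sup>2"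
      unfolding norm_damp[OF assms(1)]
      using assms by (auto simp: distrib_left intro!: mult_left_le_one_le power_le_one)
    then show "(\<delta> * norm v)\<^sup>2 \<le> (norm (damp \<delta> e v))\<^sup>2" by (simp add: power_mult_distrib)
  qed auto
  then show ?thesis using assms by (simp add: field_simps)
qed

lemma symplectic_J_mult: "(symplectic_J *v v) $ 1 = - v $ 2" "(symplectic_J *v v) $ 2 = v $ 1"
  by (simp_all add: symplectic_J_def matrix_vector_mult_def sum_2)

lemma norm_symplectic_J: "norm (symplectic_J *v v) = norm v"
proof -
  have "(norm (symplectic_J *v v))\<^sup>2 = (norm v)\<^sup>2"
    unfolding norm_complex2 symplectic_J_mult by simp
  then show ?thesis by simp
qed

text \<open>The image is \<open>along e v\<close> times \<open>J e\<close>: it has no component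
  along \<open>e\<close>, and its only component is damped by \<open>\<delta>\<close>.\<close>

lemma norm_damp_generator_proj:
  assumes "norm e = 1" "0 \<le> \<delta>"
  shows "norm (damp \<delta> e (symplectic_J *v (proj e *v v))) \<le> \<delta> * norm (damp \<delta> e v)"
proof (rule power2_le_imp_le)
  let ?w = "symplectic_J *v (proj e *v v)"
  have "(e$1)\<^sup>2 + (e$2)\<^sup>2 = 1"
    using norm_real2[of e] assms by simp
  then have ec: "complex_of_real (e$1) * complex_of_real (e$1) + complex_of_real (e$2) * complex_of_real (e$2) = 1"
    by (metis of_real_1 of_real_add of_real_mult power2_eq_square)
  have P: "(proj e *v v) $ 1 = of_real (e$1) * along e v" "(proj e *v v) $ 2 = of_real (e$2) * along e v"
    by (simp_all add: proj_def along_def matrix_vector_mult_def sum_2 algebra_simps)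
  have 1: "along e ?w = 0"
    unfolding along_def symplectic_J_mult P by (simp add: algebra_simps)
  have "across e ?w = (complex_of_real (e$1) * complex_of_real (e$1) + complex_of_real (e$2) * complex_of_real (e$2)) * along e v"
    unfolding across_def symplectic_J_mult P by (simp add: algebra_simps)
  then have 2: "across e ?w = along e v"
    unfolding ec by simp
  show "(norm (damp \<delta> e ?w))\<^sup>2 \<le> (\<delta> * norm (damp \<delta> e v))\<^sup>2"
    unfolding power_mult_distrib norm_damp[OF assms(1)] 1 2 by (simp add: distrib_left)
qed (use assms in auto)

text \<open>\<open>A\<close> is split into \<open>proj e\<close> and an error. The first part gains
  \<open>\<delta>\<close>; the error is controlled by the undamped norm of \<open>v\<close>, and
  returning to the damped norm costs \<open>1 / \<delta>\<close>.\<close>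

lemma norm_damp_generator:
  assumes "norm e = 1" "0 < \<delta>" "\<delta> \<le> 1"
    and w: "symplectic_J *v w = z *s (A *v v)"
  shows "norm (damp \<delta> e w) \<le> cmod z * (\<delta> + opnorm (A - proj e) / \<delta>) * norm (damp \<delta> e v)"
proof -
  let ?E = "symplectic_J *v ((A - proj e) *v v)"
  have "A *v v = proj e *v v + (A - proj e) *v v"
    by (simp add: matrix_vector_mult_diff_rdistrib)
  then have split: "symplectic_J *v (A *v v) = symplectic_J *v (proj e *v v) + ?E"
    by (metis matrix_vector_right_distrib)
  \<comment> \<open>The equation is solved for \<open>w\<close> using that the square of
    \<open>J\<close> is minus the identity.\<close>
  have "w = (- z) *s (symplectic_J *v (A *v v))"
    using arg_cong[OF w, of "\<lambda>u. u $ 1"] arg_cong[OF w, of "\<lambda>u. u $ 2"]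
    by (simp add: vec_eq_iff forall_2 symplectic_J_mult) (metis minus_minus)
  then have "norm (damp \<delta> e w) = cmod z * norm (damp \<delta> e (symplectic_J *v (A *v v)))"
    using norm_damp_scale[OF assms(1), of \<delta> "- z"] by simp
  also have "\<dots> \<le> cmod z * (norm (damp \<delta> e (symplectic_J *v (proj e *v v))) + norm (damp \<delta> e ?E))"
    unfolding split damp_add by (intro mult_left_mono norm_triangle_ineq) auto
  also have "\<dots> \<le> cmod z * (\<delta> * norm (damp \<delta> e v) + opnorm (A - proj e) * (norm (damp \<delta> e v) / \<delta>))"
  proof (intro mult_left_mono add_mono)
    show "norm (damp \<delta> e (symplectic_J *v (proj e *v v))) \<le> \<delta> * norm (damp \<delta> e v)"
      using assms by (intro norm_damp_generator_proj) auto
    have "norm (damp \<delta> e ?E) \<le> norm ((A - proj e) *v v)"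
      using norm_damp_le[of e \<delta> ?E] assms by (simp add: norm_symplectic_J)
    also have "\<dots> \<le> opnorm (A - proj e) * norm v"
      by (rule norm_mult_vec_le_opnorm)
    also have "\<dots> \<le> opnorm (A - proj e) * (norm (damp \<delta> e v) / \<delta>)"
      using assms by (intro mult_left_mono norm_le_damp opnorm_nonneg) auto
    finally show "norm (damp \<delta> e ?E) \<le> opnorm (A - proj e) * (norm (damp \<delta> e v) / \<delta>)" .
  qed auto
  finally show ?thesis by (simp add: algebra_simps)
qed

text \<open>The two damping maps differ by \<open>1 - \<delta>\<close> times the difference of the
  projections. Writing the factor as an exponential makes the costs at successive nodes add up to
  \<open>Var N e / \<delta>\<close>.\<close>

lemma norm_damp_change:
  assumes "norm e = 1" "0 < \<delta>" "\<delta> \<le> 1"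
  shows "norm (damp \<delta> e' v) \<le> norm (damp \<delta> e v) * exp (opnorm (proj e - proj e') / \<delta>)"
proof -
  let ?p = "opnorm (proj e - proj e')"
  have "damp \<delta> e' v = damp \<delta> e v + (1 - \<delta>) *\<^sub>R ((proj e' - proj e) *v v)"
    by (simp add: damp_def matrix_vector_mult_diff_rdistrib scaleR_diff_right)
  then have "norm (damp \<delta> e' v) \<le> norm (damp \<delta> e v) + (1 - \<delta>) * norm ((proj e' - proj e) *v v)"
    using norm_triangle_ineq[of "damp \<delta> e v" "(1 - \<delta>) *\<^sub>R ((proj e' - proj e) *v v)"] assms by simp
  also have "\<dots> \<le> norm (damp \<delta> e v) + 1 * (?p * (norm (damp \<delta> e v) / \<delta>))"
  proof (intro add_left_mono mult_mono)
    have "norm ((proj e' - proj e) *v v) \<le> ?p * norm v"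
      using norm_mult_vec_le_opnorm[of "proj e' - proj e" v] by (simp add: opnorm_minus_commute)
    also have "\<dots> \<le> ?p * (norm (damp \<delta> e v) / \<delta>)"
      using assms by (intro mult_left_mono norm_le_damp opnorm_nonneg) auto
    finally show "norm ((proj e' - proj e) *v v) \<le> ?p * (norm (damp \<delta> e v) / \<delta>)" .
  qed (use assms in auto)
  also have "\<dots> = norm (damp \<delta> e v) * (1 + ?p / \<delta>)"
    by (simp add: algebra_simps)
  also have "\<dots> \<le> norm (damp \<delta> e v) * exp (?p / \<delta>)"
    by (intro mult_left_mono exp_ge_add_one_self) auto
  finally show ?thesis .
qed

section \<open>Finite rank Hamiltonians and the bound on the monodromy matrix\<close>

lemma finite_rank_hamiltonian_nodes:
  assumes "finite_rank_hamiltonian L N x e G" "i \<le> j" "j \<le> N"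
  shows "x i \<le> x j"
  using assms(2,3)
proof (induction rule: dec_induct)
  case (step n)
  then have "x n < x (Suc n)" using assms(1) by (auto simp: finite_rank_hamiltonian_def)
  then show ?case using step by auto
qed simp

text \<open>The values of \<open>G\<close> at the nodes are arbitrary, so on each closed interval
  \<open>G\<close> agrees with a constant off the two endpoints; the pieces are glued by induction.
  This makes the operator norm of \<open>H - G\<close> integrable.\<close>

lemma finite_rank_hamiltonian_absolutely_integrable:
  assumes "finite_rank_hamiltonian L N x e G"
  shows "G absolutely_integrable_on {0..L}"
proof -
  have "j \<le> N \<Longrightarrow> G absolutely_integrable_on {0..x j}" for j
  proof (induction j)
    case 0
    then show ?case
      using assms by (simp add: finite_rank_hamiltonian_def absolutely_integrable_negligible)
  next
    case (Suc j)
    then have "\<forall>t\<in>{x j<..<x (Suc j)}. G t = proj (e j)"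
      using assms unfolding finite_rank_hamiltonian_def by simp
    then have G_eq: "proj (e j) = G t" if "x j \<le> t" "t \<le> x (Suc j)" "t \<noteq> x j" "t \<noteq> x (Suc j)" for t
      using that by auto
    have "G absolutely_integrable_on {x j..x (Suc j)} \<longleftrightarrow> (\<lambda>t. proj (e j)) absolutely_integrable_on {x j..x (Suc j)}"
      by (rule absolutely_integrable_spike_eq[of "{x j, x (Suc j)}"])
        (use G_eq in auto)
    then have "G absolutely_integrable_on {x j..x (Suc j)}"
      using absolutely_integrable_on_const[of "{x j..x (Suc j)}"] by simp
    moreover have "0 \<le> x j" "x j \<le> x (Suc j)"
      using finite_rank_hamiltonian_nodes[OF assms, of 0 j] finite_rank_hamiltonian_nodes[OF assms, of j "Suc j"]
        Suc assms by (auto simp: finite_rank_hamiltonian_def)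
    ultimately show ?case
      using Suc absolutely_integrable_on_combine by (metis Suc_leD)
  qed
  then show ?thesis using assms by (auto simp: finite_rank_hamiltonian_def)
qed

text \<open>With \<open>\<delta>\<close> and \<open>G\<close> still free, Gronwall is applied on
  each interval in its own damped norm, and the norm is changed at each interior node. The start
  costs nothing, as damping does not increase the norm; the last factor \<open>1 / \<delta>\<close>
  pays for the return to the Euclidean norm at \<open>L\<close>.\<close>

lemma opnorm_monodromy_le:
  assumes "L > 0" and H: "H absolutely_integrable_on {0..L}"
    and M: "matrix_solution H L M" and G: "finite_rank_hamiltonian L N x e G"
    and \<delta>: "0 < \<delta>" "\<delta> \<le> 1"
  shows "opnorm (M L z) \<le>
    exp (2 * cmod z * (\<delta> * L + L1_norm L (\<lambda>t. H t - G t) / \<delta>) + Var N e / \<delta>) / \<delta>"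
proof -
  define h where "h t = opnorm (H t - G t)" for t
  define \<kappa> where "\<kappa> t = cmod z * (\<delta> + h t / \<delta>)" for t
  have h: "h absolutely_integrable_on {0..L}"
    unfolding h_def using finite_rank_hamiltonian_absolutely_integrable[OF G] H
    by (intro absolutely_integrable_opnorm) auto
  have h_int: "h integrable_on {0..L}"
    using h by (auto simp: absolutely_integrable_on_def)
  have L1: "L1_norm L (\<lambda>t. H t - G t) = integral {0..L} h"
    using set_lebesgue_integral_eq_integral(2)[OF h] by (simp add: L1_norm_def h_def)
  have \<kappa>_has: "(\<kappa> has_integral cmod z * (\<delta> * L + integral {0..L} h / \<delta>)) {0..L}"
  proof -
    have "((\<lambda>t. \<delta>) has_integral \<delta> * L) {0..L}"
      using has_integral_const_real[of \<delta> 0 L] \<open>L > 0\<close> by (simp add: mult.commute)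
    then show ?thesis
      unfolding \<kappa>_def
      by (intro has_integral_mult_right has_integral_add has_integral_divide integrable_integral h_int)
  qed
  then have \<kappa>: "\<kappa> integrable_on {0..L}" by blast
  have \<kappa>0: "0 \<le> \<kappa> t" for t
    using \<delta> by (auto simp: \<kappa>_def h_def opnorm_nonneg intro!: mult_nonneg_nonneg add_nonneg_nonneg)
  obtain Y' where Y': "has_ac_derivative_on (\<lambda>x. M x z) Y' L"
    and eq: "AE t in lebesgue. t \<in> {0..L} \<longrightarrow> symplectic_J ** Y' t = mat z ** H t ** M t z"
    and M0: "M 0 z = mat 1"
    using M unfolding matrix_solution_def by blast
  obtain Z where Z_null: "Z \<in> null_sets lebesgue"
    and Z_eq: "\<And>t. t \<in> space lebesgue - Z \<Longrightarrow>
      t \<in> {0..L} \<longrightarrow> symplectic_J ** Y' t = mat z ** H t ** M t z"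
    by (rule AE_E3[OF eq]) (rule that)
  have Z: "negligible Z"
    using Z_null by (simp add: negligible_iff_null_sets)
  have eqZ: "symplectic_J ** Y' t = mat z ** H t ** M t z" if "t \<in> {0..L} - Z" for t
    using Z_eq[of t] that by auto
  have x0: "x 0 = 0" and xN: "x N = L" and e: "\<And>j. j < N \<Longrightarrow> norm (e j) = 1"
    using G by (simp_all add: finite_rank_hamiltonian_def)
  then have N: "N > 0"
    using \<open>L > 0\<close> by (cases N) auto
  have nodes: "0 \<le> x j \<and> x j \<le> x (Suc j) \<and> x (Suc j) \<le> L" if "j < N" for j
    using finite_rank_hamiltonian_nodes[OF G, of 0 j] finite_rank_hamiltonian_nodes[OF G, of j "Suc j"]
      finite_rank_hamiltonian_nodes[OF G, of "Suc j" N] that x0 xN by auto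
  have "norm (M L z *v v) \<le>
    exp (2 * cmod z * (\<delta> * L + integral {0..L} h / \<delta>) + Var N e / \<delta>) / \<delta> * norm v" for v
  proof -
    define y where "y t = M t z *v v" for t
    define F where "F t = Y' t *v v" for t
    have lin: "bounded_linear (\<lambda>A::cmat2. A *v v)"
      unfolding linear_conv_bounded_linear[symmetric]
      by (rule linearI)
        (simp_all add: matrix_vector_mult_def vec_eq_iff distrib_right sum.distrib scaleR_right.sum)
    have Y'_int: "Y' integrable_on {0..L}"
      using Y' by (auto simp: has_ac_derivative_on_def absolutely_integrable_on_def)
    have y_rep: "y t = y s + integral {s..t} F" and F_int: "F integrable_on {s..t}"
      if "0 \<le> s" "s \<le> t" "t \<le> L" for s t
    proof -
      have Y: "Y' integrable_on {a..b}" if "0 \<le> a" "b \<le> L" for a b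
        using that by (intro integrable_subinterval_real[OF Y'_int]) auto
      have Fc: "F = (\<lambda>A. A *v v) \<circ> Y'" by (auto simp: F_def)
      have Y_st: "Y' integrable_on {s..t}"
        using that by (intro Y) auto
      then show "F integrable_on {s..t}"
        unfolding Fc using lin by (rule integrable_linear)
      have "M t z = M 0 z + integral {0..t} Y'" "M s z = M 0 z + integral {0..s} Y'"
        using Y' that unfolding has_ac_derivative_on_def by (meson atLeastAtMost_iff order_trans)+
      moreover have "integral {0..s} Y' + integral {s..t} Y' = integral {0..t} Y'"
        using that by (intro Henstock_Kurzweil_Integration.integral_combine Y) auto
      ultimately have "M t z = M s z + integral {s..t} Y'" by (simp add: algebra_simps)
      moreover have "integral {s..t} F = integral {s..t} Y' *v v"
        unfolding Fc by (rule integral_linear[OF Y_st lin])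
      ultimately show "y t = y s + integral {s..t} F"
        by (simp add: y_def matrix_vector_mult_add_rdistrib)
    qed
    have ode: "symplectic_J *v F t = z *s (H t *v y t)" if "t \<in> {0..L} - Z" for t
    proof -
      have "mat z *v u = z *s u" for u :: "complex^2"
        by (simp add: vec_eq_iff forall_2 matrix_vector_mult_def mat_def sum_2)
      then show ?thesis
        using arg_cong[OF eqZ[OF that], of "\<lambda>A. A *v v"]
        by (simp add: F_def y_def matrix_vector_mul_assoc[symmetric])
    qed
    have step: "norm (damp \<delta> (e j) (y (x (Suc j)))) \<le>
        norm (damp \<delta> (e j) (y (x j))) * exp (2 * integral {x j..x (Suc j)} \<kappa>)" if "j < N" for j
    proof (rule integral_gronwall[where W = "\<lambda>t. damp \<delta> (e j) (y t)" and F = "damp \<delta> (e j) \<circ> F"])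
      \<comment> \<open>The nodes join the exceptional set because \<open>G\<close> is prescribed
        only between them.\<close>
      show "negligible (Z \<union> {x j, x (Suc j)})"
        using Z by (simp add: negligible_Un)
      show "x j \<le> x (Suc j)" using nodes[OF that] by simp
      show "damp \<delta> (e j) \<circ> F integrable_on {x j..x (Suc j)}"
        using nodes[OF that] by (intro integrable_linear F_int bounded_linear_damp) auto
      show "\<kappa> integrable_on {x j..x (Suc j)}"
        using nodes[OF that] by (intro integrable_subinterval_real[OF \<kappa>]) auto
      show "damp \<delta> (e j) (y t) = damp \<delta> (e j) (y (x j)) + integral {x j..t} (damp \<delta> (e j) \<circ> F)"
        if "t \<in> {x j..x (Suc j)}" for t
      proof -
        have *: "0 \<le> x j" "x j \<le> t" "t \<le> L" using nodes[OF \<open>j < N\<close>] that by auto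
        show ?thesis
          unfolding integral_linear[OF F_int[OF *] bounded_linear_damp] damp_add[symmetric]
          using y_rep[OF *] by simp
      qed
      show "norm ((damp \<delta> (e j) \<circ> F) t) \<le> \<kappa> t * norm (damp \<delta> (e j) (y t))"
        if "t \<in> {x j..x (Suc j)} - (Z \<union> {x j, x (Suc j)})" for t
      proof -
        have "\<forall>t\<in>{x j<..<x (Suc j)}. G t = proj (e j)"
          using G \<open>j < N\<close> unfolding finite_rank_hamiltonian_def by simp
        then have "G t = proj (e j)"
          using that by simp
        moreover have "t \<in> {0..L} - Z"
          using that nodes[OF \<open>j < N\<close>] by auto
        ultimately show ?thesis
          using norm_damp_generator[OF e[OF \<open>j < N\<close>] \<delta> ode] by (simp add: \<kappa>_def h_def)
      qed
    qed (use \<kappa>0 in auto)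
    \<comment> \<open>Reaching the end of interval \<open>j\<close> takes \<open>j\<close> changes
      of norm, so the sum runs over \<open>i < j\<close>, and \<open>j = N - 1\<close> yields
      exactly \<open>Var N e\<close>.\<close>
    have telescope: "norm (damp \<delta> (e j) (y (x (Suc j)))) \<le> norm v *
        exp (2 * integral {0..x (Suc j)} \<kappa> + (\<Sum>i<j. opnorm (proj (e i) - proj (e (Suc i)))) / \<delta>)"
      if "j < N" for j
      using that
    proof (induction j)
      case 0
      have "norm (damp \<delta> (e 0) (y (x 0))) \<le> norm v"
        using norm_damp_le[OF e[OF 0] _ \<delta>(2)] \<delta> by (simp add: y_def x0 M0)
      then have "norm (damp \<delta> (e 0) (y (x 0))) * exp (2 * integral {x 0..x (Suc 0)} \<kappa>) \<le>
          norm v * exp (2 * integral {x 0..x (Suc 0)} \<kappa>)"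
        by (rule mult_right_mono) simp
      from order_trans[OF step[OF 0] this] show ?case
        unfolding x0 by simp
    next
      case (Suc j)
      let ?S = "(\<Sum>i<j. opnorm (proj (e i) - proj (e (Suc i)))) / \<delta>"
      let ?p = "opnorm (proj (e j) - proj (e (Suc j))) / \<delta>"
      let ?I = "integral {0..x (Suc j)} \<kappa>" and ?K = "integral {x (Suc j)..x (Suc (Suc j))} \<kappa>"
      have j: "j < N" using Suc by simp
      have "norm (damp \<delta> (e (Suc j)) (y (x (Suc (Suc j))))) \<le>
          norm (damp \<delta> (e (Suc j)) (y (x (Suc j)))) * exp (2 * ?K)"
        by (rule step) (use Suc in auto)
      also have "\<dots> \<le> (norm (damp \<delta> (e j) (y (x (Suc j)))) * exp ?p) * exp (2 * ?K)"
        by (intro mult_right_mono norm_damp_change e j \<delta>) auto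
      also have "\<dots> \<le> ((norm v * exp (2 * ?I + ?S)) * exp ?p) * exp (2 * ?K)"
        by (intro mult_right_mono Suc.IH j) auto
      also have "\<dots> = norm v * exp (2 * (?I + ?K) + (?S + ?p))"
        by (simp add: exp_add distrib_left mult_ac)
      also have "?I + ?K = integral {0..x (Suc (Suc j))} \<kappa>"
        using nodes[OF j] nodes[OF Suc.prems]
        by (intro Henstock_Kurzweil_Integration.integral_combine integrable_subinterval_real[OF \<kappa>]) auto
      finally show ?case by (simp add: add_divide_distrib)
    qed
    have "norm (y L) \<le> norm (damp \<delta> (e (N - 1)) (y L)) / \<delta>"
      using N \<delta> e by (intro norm_le_damp) auto
    also have "\<dots> \<le> (norm v * exp (2 * integral {0..L} \<kappa> + Var N e / \<delta>)) / \<delta>"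
      using telescope[of "N - 1"] N \<delta> xN by (intro divide_right_mono) (auto simp: Var_def)
    finally show ?thesis
      unfolding integral_unique[OF \<kappa>_has] by (simp add: y_def mult_ac)
  qed
  then show ?thesis
    unfolding L1 by (rule opnorm_le)
qed

section \<open>Order of growth and choice of parameters\<close>

text \<open>\<open>ln (B * r powr d) / ln r\<close> equals \<open>d + ln B / ln r\<close>, and the
  last term vanishes at infinity. The assumptions \<open>1 \<le> B\<close> and
  \<open>0 \<le> d\<close> make the majorant at least 1, so it also dominates the truncation
  \<open>max 1\<close>.\<close>

lemma growth_order_le:
  assumes "1 \<le> B" "0 \<le> d" and nonneg: "\<And>z. 0 \<le> \<phi> z"
    and bound: "\<And>z. 1 \<le> cmod z \<Longrightarrow> \<phi> z \<le> exp (B * cmod z powr d)"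
  shows "growth_order \<phi> \<le> ereal d"
proof -
  \<comment> \<open>Radius 2 rather than 1 makes \<open>ln (cmod z)\<close> positive, as the
    division requires.\<close>
  have "eventually (\<lambda>z::complex. 2 \<le> cmod z) at_infinity"
    unfolding eventually_at_infinity by blast
  then have "eventually (\<lambda>z. ereal (ln (max 1 (ln (\<phi> z))) / ln (cmod z)) \<le> ereal (ln B / ln (cmod z) + d)) at_infinity"
  proof eventually_elim
    case (elim z)
    define r where "r = cmod z"
    have r: "r > 1" using elim by (simp add: r_def)
    have p: "1 \<le> r powr d" using r \<open>0 \<le> d\<close> by (simp add: ge_one_powr_ge_zero)
    have "1 * 1 \<le> B * r powr d" using p \<open>1 \<le> B\<close> by (intro mult_mono) auto
    then have B: "1 \<le> B * r powr d" by simp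
    have "ln (\<phi> z) \<le> B * r powr d"
    \<comment> \<open>At a zero of \<open>\<phi>\<close> the convention \<open>ln 0 = 0\<close>
      makes the bound trivial.\<close>
    proof (cases "\<phi> z = 0")
      case False
      then have "0 < \<phi> z" using nonneg[of z] by simp
      then have "ln (\<phi> z) \<le> ln (exp (B * r powr d))"
        using bound[of z] elim unfolding r_def by (intro ln_mono) auto
      then show ?thesis by simp
    qed (use B in simp)
    then have "ln (max 1 (ln (\<phi> z))) \<le> ln (B * r powr d)"
      using B by (intro ln_mono) auto
    also have "\<dots> = ln B + d * ln r"
      using \<open>1 \<le> B\<close> r by (simp add: ln_mult ln_powr)
    finally have "ln (max 1 (ln (\<phi> z))) / ln r \<le> (ln B + d * ln r) / ln r"
      using r by (intro divide_right_mono) auto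
    also have "\<dots> = ln B / ln r + d" using r by (simp add: add_divide_distrib)
    finally show ?case by (simp add: r_def)
  qed
  then have "growth_order \<phi> \<le> Limsup at_infinity (\<lambda>z. ereal (ln B / ln (cmod z) + d))"
    unfolding growth_order_def by (rule Limsup_mono)
  also have "\<dots> = ereal d"
  proof (rule lim_imp_Limsup)
    have "filterlim (\<lambda>z::complex. ln (cmod z)) at_top at_infinity"
      by (rule filterlim_compose[OF ln_at_top filterlim_norm_at_top])
    then have "((\<lambda>z. ln B / ln (cmod z)) \<longlongrightarrow> 0) at_infinity"
      by (rule real_tendsto_divide_at_top[OF tendsto_const])
    then show "((\<lambda>z. ereal (ln B / ln (cmod z) + d)) \<longlongrightarrow> ereal d) at_infinity"
      using tendsto_add[OF _ tendsto_const, of _ 0 at_infinity d] by fastforce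
  qed (rule trivial_limit_at_infinity)
  finally show ?thesis .
qed

theorem corollary3:
  fixes H :: "real \<Rightarrow> cmat2" and M :: "real \<Rightarrow> complex \<Rightarrow> cmat2" and L d C :: real
  assumes "canonical_system H L"
    and "matrix_solution H L M"
    and "1/2 \<le> d" and "d < 1"
    and "C > 0"
    and "\<And>\<epsilon>::real. \<epsilon> > 0 \<Longrightarrow>
           \<exists>G N x e. finite_rank_hamiltonian L N x e G \<and>
             L1_norm L (\<lambda>t. H t - G t) \<le> \<epsilon> \<and>
             Var N e \<le> C * \<epsilon> powr ((2 * d - 1) / (2 * d - 2))"
  shows "growth_order (\<lambda>z. opnorm (M L z)) \<le> ereal d \<and>
    (\<forall>i j. growth_order (\<lambda>z. cmod (M L z $ i $ j)) \<le> ereal d)"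
proof -
  have L: "L > 0" and H: "H absolutely_integrable_on {0..L}"
    using assms(1) by (simp_all add: canonical_system_def)
  \<comment> \<open>The summands come from the Gronwall exponent, from \<open>Var\<close>, and from
    absorbing the factor \<open>1 / \<delta>\<close> into an exponential.\<close>
  define B where "B = 2 * (L + 1) + C + 1"
  have bound: "opnorm (M L z) \<le> exp (B * cmod z powr d)" if "1 \<le> cmod z" for z
  proof -
    define r where "r = cmod z"
    define \<delta> where "\<delta> = r powr (d - 1)"
    define \<epsilon> where "\<epsilon> = r powr (2 * d - 2)"
    have r: "1 \<le> r" using that by (simp add: r_def)
    then have \<delta>: "0 < \<delta>" "\<delta> \<le> 1" "\<epsilon> > 0"
      using \<open>d < 1\<close> powr_mono[of "d - 1" 0 r] by (auto simp: \<delta>_def \<epsilon>_def)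
    obtain G N x e where G: "finite_rank_hamiltonian L N x e G"
      and L1: "L1_norm L (\<lambda>t. H t - G t) \<le> \<epsilon>"
      and V: "Var N e \<le> C * \<epsilon> powr ((2 * d - 1) / (2 * d - 2))"
      using assms(6)[OF \<delta>(3)] by blast
    have r\<delta>: "r * \<delta> = r powr d" and \<epsilon>\<delta>: "\<epsilon> / \<delta> = \<delta>"
      using r by (simp_all add: \<delta>_def \<epsilon>_def powr_mult_base powr_diff[symmetric])
    have "L1_norm L (\<lambda>t. H t - G t) / \<delta> \<le> \<delta>"
      using divide_right_mono[OF L1, of \<delta>] \<delta> unfolding \<epsilon>\<delta> by simp
    then have "2 * r * (\<delta> * L + L1_norm L (\<lambda>t. H t - G t) / \<delta>) \<le> 2 * r * (\<delta> * L + \<delta>)"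
      using r by (intro mult_left_mono) auto
    also have "\<dots> = 2 * (L + 1) * r powr d"
      unfolding r\<delta>[symmetric] by (simp add: algebra_simps)
    finally have 1: "2 * r * (\<delta> * L + L1_norm L (\<lambda>t. H t - G t) / \<delta>) \<le> 2 * (L + 1) * r powr d" .
    \<comment> \<open>The exponent in the hypothesis on \<open>Var\<close> cancels
      \<open>2 * d - 2\<close>, which is nonzero as \<open>d < 1\<close>; dividing by
      \<open>\<delta>\<close> then leaves \<open>r powr d\<close>.\<close>
    have "\<epsilon> powr ((2 * d - 1) / (2 * d - 2)) = r powr (2 * d - 1)"
      using \<open>d < 1\<close> by (simp add: \<epsilon>_def powr_powr)
    then have "Var N e / \<delta> \<le> C * r powr (2 * d - 1) / \<delta>"
      using V \<delta> by (intro divide_right_mono) auto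
    also have "\<dots> = C * r powr d"
      using powr_diff[of r "2 * d - 1" "d - 1"] by (simp add: \<delta>_def)
    finally have 2: "Var N e / \<delta> \<le> C * r powr d" .
    have "1 / \<delta> = r powr (1 - d)"
      using r by (simp add: \<delta>_def powr_minus_divide[symmetric])
    \<comment> \<open>Here \<open>1/2 \<le> d\<close> enters, in the form
      \<open>1 - d \<le> d\<close>.\<close>
    also have "\<dots> \<le> r powr d"
      using r \<open>1/2 \<le> d\<close> by (intro powr_mono) auto
    also have "\<dots> \<le> exp (r powr d)"
      using exp_ge_add_one_self[of "r powr d"] by linarith
    finally have 3: "1 / \<delta> \<le> exp (r powr d)" .
    have "opnorm (M L z) \<le>
        exp (2 * r * (\<delta> * L + L1_norm L (\<lambda>t. H t - G t) / \<delta>) + Var N e / \<delta>) * (1 / \<delta>)"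
      using opnorm_monodromy_le[OF L H assms(2) G \<delta>(1,2)] by (simp add: r_def)
    also have "\<dots> \<le> exp (2 * (L + 1) * r powr d + C * r powr d) * exp (r powr d)"
      using 1 2 3 \<delta> by (intro mult_mono) auto
    also have "\<dots> = exp (B * r powr d)"
      by (simp add: B_def exp_add[symmetric] algebra_simps)
    finally show ?thesis by (simp add: r_def)
  qed
  have B: "1 \<le> B" using L \<open>C > 0\<close> by (simp add: B_def)
  show ?thesis
  proof (intro conjI allI)
    show "growth_order (\<lambda>z. opnorm (M L z)) \<le> ereal d"
      by (rule growth_order_le[OF B]) (use \<open>1/2 \<le> d\<close> bound opnorm_nonneg in auto)
    fix i j
    show "growth_order (\<lambda>z. cmod (M L z $ i $ j)) \<le> ereal d"
      by (rule growth_order_le[OF B])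
        (use \<open>1/2 \<le> d\<close> in \<open>auto intro: order_trans[OF norm_entry_le_opnorm bound]\<close>)
  qed
qed

end
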